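(* For every positive integer $n$ divisible by $4$, there exist an $n$-dimensional acyclic unique sink orientation (AUSO) $\psi$ of the hypercube $Q^n$, a starting vertex $v_0 \in Q^n$, and an ordered list $L$ of the $2n$ directions $\pm[n]$ such that Cunningham's least-recently considered rule with list $L$, started at $v_0$, takes a path of length at least $2^{n/4}$ (i.e. makes at least $2^{n/4}$ steps) before reaching the global sink of $\psi$.
   Context: The $n$-dimensional hypercube $Q^n$ has vertex set $2^{[n]}$ (subsets of $[n]=\{1,\dots,n\}$), with $u,v$ adjacent iff $|u\oplus v|=1$ ($\oplus$ = symmetric difference); the edge between $v$ and $v\oplus\{j\}$ is said to be on coordinate $j$. A face is a set $F(C,v)=\{u : u\oplus v\subseteq C\}$ for $C\subseteq[n]$, $v\in Q^n$. A unique sink orientation (USO) is an orientation of the edges of $Q^n$ such that every nonempty face has exactly one sink (a vertex of the face with no outgoing edge to another vertex of the face); an AUSO is an acyclic USO. The global sink is the unique vertex with no outgoing edges. A direction is a signed coordinate $\pm c$, $c\in[n]$; at vertex $v$, direction $+c$ refers to the edge to $v\cup\{c\}$ (when $c\notin v$) and $-c$ to the edge to $v\setminus\{c\}$ (when $c\in v$). A direction is available at $v$ if the corresponding edge exists and is oriented out of $v$. Cunningham's least-recently considered rule: given an ordered list $L=(L[1],\dots,L[2n])$ of all $2n$ directions, keep a marker $\mu$, initially $\mu=2n$. At each step, at the current vertex (if it is not the global sink), scan the list cyclically starting from $L[\mu+1]$ (continuing from $L[1]$ after $L[2n]$), take the first available direction $L[k]$, move along it, and set $\mu=k$. The walk stops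 at the global sink. *)

theory Defs
  imports Main
begin

text \<open>Vertices of Q^n are subsets of {1..n}. An orientation is a predicate
  out :: nat set => nat => bool, where out v j means the edge of v on
  coordinate j is oriented out of v.\<close>

definition flip :: "nat set \<Rightarrow> nat \<Rightarrow> nat set" where
  "flip v j = (if j \<in> v then v - {j} else insert j v)"

definition vertices :: "nat \<Rightarrow> nat set set" where
  "vertices n = Pow {1..n}"

definition is_orientation :: "nat \<Rightarrow> (nat set \<Rightarrow> nat \<Rightarrow> bool) \<Rightarrow> bool" where
  "is_orientation n out \<longleftrightarrow>
     (\<forall>v \<in> vertices n. \<forall>j \<in> {1..n}. out v j \<longleftrightarrow> \<not> out (flip v j) j)"

definition face :: "nat set \<Rightarrow> nat set \<Rightarrow> nat set set" where
  "face C v = {u. (u - v) \<union> (v - u) \<subseteq> C}"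

definition face_sink :: "(nat set \<Rightarrow> nat \<Rightarrow> bool) \<Rightarrow> nat set \<Rightarrow> nat set \<Rightarrow> nat set \<Rightarrow> bool" where
  "face_sink out C v u \<longleftrightarrow> u \<in> face C v \<and> (\<forall>j \<in> C. \<not> out u j)"

definition is_uso :: "nat \<Rightarrow> (nat set \<Rightarrow> nat \<Rightarrow> bool) \<Rightarrow> bool" where
  "is_uso n out \<longleftrightarrow> is_orientation n out \<and>
     (\<forall>C \<subseteq> {1..n}. \<forall>v \<in> vertices n. \<exists>!u. face_sink out C v u)"

definition orient_edges :: "nat \<Rightarrow> (nat set \<Rightarrow> nat \<Rightarrow> bool) \<Rightarrow> (nat set \<times> nat set) set" where
  "orient_edges n out = {(u, flip u j) | u j. u \<in> vertices n \<and> j \<in> {1..n} \<and> out u j}"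

definition is_auso :: "nat \<Rightarrow> (nat set \<Rightarrow> nat \<Rightarrow> bool) \<Rightarrow> bool" where
  "is_auso n out \<longleftrightarrow> is_uso n out \<and> acyclic (orient_edges n out)"

definition global_sink :: "nat \<Rightarrow> (nat set \<Rightarrow> nat \<Rightarrow> bool) \<Rightarrow> nat set \<Rightarrow> bool" where
  "global_sink n out v \<longleftrightarrow> v \<in> vertices n \<and> (\<forall>j \<in> {1..n}. \<not> out v j)"

definition directions :: "nat \<Rightarrow> int set" where
  "directions n = {d. d \<noteq> 0 \<and> nat \<bar>d\<bar> \<in> {1..n}}"

definition valid_list :: "nat \<Rightarrow> int list \<Rightarrow> bool" where
  "valid_list n L \<longleftrightarrow> distinct L \<and> set L = directions n \<and> length L = 2 * n"

definition available :: "(nat set \<Rightarrow> nat \<Rightarrow> bool) \<Rightarrow> nat set \<Rightarrow> int \<Rightarrow> bool" where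
  "available out v d \<longleftrightarrow>
     (if d > 0 then nat d \<notin> v \<and> out v (nat d)
      else nat (- d) \<in> v \<and> out v (nat (- d)))"

text \<open>Cyclic scan order of (1-based) list positions, starting at mu+1.\<close>
definition scan_order :: "nat \<Rightarrow> nat \<Rightarrow> nat list" where
  "scan_order n mu = [mu + 1..<2 * n + 1] @ [1..<mu + 1]"

definition next_index :: "nat \<Rightarrow> (nat set \<Rightarrow> nat \<Rightarrow> bool) \<Rightarrow> int list \<Rightarrow> nat set \<Rightarrow> nat \<Rightarrow> nat option" where
  "next_index n out L v mu = find (\<lambda>k. available out v (L ! (k - 1))) (scan_order n mu)"

fun cunningham :: "nat \<Rightarrow> (nat set \<Rightarrow> nat \<Rightarrow> bool) \<Rightarrow> int list \<Rightarrow> nat set \<Rightarrow> nat \<Rightarrow> nat set \<times> nat" where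
  "cunningham n out L v0 0 = (v0, 2 * n)"
| "cunningham n out L v0 (Suc i) =
     (let (v, mu) = cunningham n out L v0 i in
      if global_sink n out v then (v, mu) else
      (case next_index n out L v mu of
         None \<Rightarrow> (v, mu)
       | Some k \<Rightarrow> (flip v (nat \<bar>L ! (k - 1)\<bar>), k)))"

end

theory Submission
  imports Defs
begin

text \<open>Cunningham's rule amounts to scanning the list cyclically and taking each direction that is
  available when it comes up, so the number of full rounds before the sink is a lower bound for
  the number of steps. Four new coordinates \<open>p\<close>, \<open>q\<close>, \<open>r\<close>, \<open>z\<close> double the number of rounds.
  Over each vertex \<open>v\<close> of the old cube put a 3-dimensional AUSO on \<open>pqr\<close> with sink \<open>111\<close>. The face
  \<open>pqr = 111\<close> is then a hypersink, so it may be reoriented freely: for \<open>z = 0\<close> all old coordinates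
  point to the old starting vertex \<open>v0\<close>, for \<open>z = 1\<close> the old orientation is used again. While the old
  walk runs, two kinds of fibres are alternated along it, so that one round takes \<open>pqr\<close> from \<open>010\<close>
  to \<open>001\<close> and the next one back, never reaching \<open>111\<close>. Once the old sink is reached, the uniform
  fibre there moves \<open>pqr\<close> to \<open>111\<close>, the rest of that round resets the old coordinates to \<open>v0\<close>, then
  \<open>z\<close> is set and the old walk is repeated.\<close>

section \<open>Scanning a list of directions cyclically\<close>

definition scan_step :: "(nat set \<Rightarrow> nat \<Rightarrow> bool) \<Rightarrow> nat set \<Rightarrow> int \<Rightarrow> nat set" where
  "scan_step out v d = (if available out v d then flip v (nat \<bar>d\<bar>) else v)"

abbreviation scan_round :: "(nat set \<Rightarrow> nat \<Rightarrow> bool) \<Rightarrow> int list \<Rightarrow> nat set \<Rightarrow> nat set" where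
  "scan_round out L v \<equiv> foldl (scan_step out) v L"

text \<open>Time counts inspected list entries, not moves. Multiples of \<open>length L\<close> end
  complete rounds, and the residue of the time takes over the role of Cunningham's marker.\<close>

fun scan :: "(nat set \<Rightarrow> nat \<Rightarrow> bool) \<Rightarrow> int list \<Rightarrow> nat set \<Rightarrow> nat \<Rightarrow> nat set" where
  "scan out L v0 0 = v0"
| "scan out L v0 (Suc j) = scan_step out (scan out L v0 j) (L ! (j mod length L))"

lemma flip_in_vertices: "v \<in> vertices n \<Longrightarrow> j \<in> {1..n} \<Longrightarrow> flip v j \<in> vertices n"
  by (auto simp: vertices_def flip_def)

lemma available_imp_out: "available out v d \<Longrightarrow> out v (nat \<bar>d\<bar>)"
  by (auto simp: available_def split: if_splits)

lemma directions_iff: "d \<in> directions n \<longleftrightarrow> nat \<bar>d\<bar> \<in> {1..n}"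
  by (auto simp: directions_def)

lemma scan_step_in_vertices:
  "v \<in> vertices n \<Longrightarrow> d \<in> directions n \<Longrightarrow> scan_step out v d \<in> vertices n"
  unfolding scan_step_def directions_iff by (simp add: flip_in_vertices)

lemma scan_step_global_sink:
  "global_sink n out v \<Longrightarrow> d \<in> directions n \<Longrightarrow> scan_step out v d = v"
  unfolding scan_step_def global_sink_def directions_iff using available_imp_out by metis

lemma scan_round_in_vertices:
  "set L \<subseteq> directions n \<Longrightarrow> v \<in> vertices n \<Longrightarrow> scan_round out L v \<in> vertices n"
  by (induction L arbitrary: v) (simp_all add: scan_step_in_vertices)

lemma exists_available:
  assumes "v \<in> vertices n" "\<not> global_sink n out v"
  shows "\<exists>d \<in> directions n. available out v d"
proof -
  obtain j where j: "j \<in> {1..n}" "out v j"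
    using assms by (auto simp: global_sink_def)
  define d where "d = (if j \<in> v then - int j else int j)"
  have "d \<in> directions n" "available out v d"
    using j by (auto simp: d_def directions_iff available_def)
  then show ?thesis by blast
qed

text \<open>Either no direction fires, so that every entry was inspected at \<open>v\<close> itself,
  or some fire and each move lowers \<open>h\<close>. For a list of all directions and
  \<open>v\<close> not the sink the second case applies, which later makes the ends of successive
  rounds distinct.\<close>

lemma scan_round_decreasing:
  fixes h :: "nat set \<Rightarrow> nat"
  assumes h: "\<And>v j. v \<in> vertices n \<Longrightarrow> j \<in> {1..n} \<Longrightarrow> out v j \<Longrightarrow> h (flip v j) < h v"
    and "set L \<subseteq> directions n" "v \<in> vertices n"
  shows "scan_round out L v \<in> vertices n \<and>
    (scan_round out L v = v \<and> (\<forall>d \<in> set L. \<not> available out v d) \<or>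
     h (scan_round out L v) < h v)"
  using assms(2,3)
proof (induction L arbitrary: v)
  case (Cons d L)
  have d: "nat \<bar>d\<bar> \<in> {1..n}"
    using Cons.prems by (simp add: directions_iff)
  have IH: "scan_round out L w \<in> vertices n \<and>
    (scan_round out L w = w \<and> (\<forall>d \<in> set L. \<not> available out w d) \<or>
     h (scan_round out L w) < h w)" if "w \<in> vertices n" for w
    using Cons.IH Cons.prems that by simp
  show ?case
  proof (cases "available out v d")
    case True
    have lt: "h (flip v (nat \<bar>d\<bar>)) < h v"
      using h[OF Cons.prems(2) d available_imp_out[OF True]] .
    show ?thesis
      using IH[OF flip_in_vertices[OF Cons.prems(2) d]] lt True
      by (auto simp: scan_step_def[of out v d])
  next
    case False
    then show ?thesis
      using IH[OF Cons.prems(2)] by (auto simp: scan_step_def[of out v d])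
  qed
qed simp

lemma scan_add_take:
  "p mod length L = 0 \<Longrightarrow> l \<le> length L \<Longrightarrow>
    scan out L v0 (p + l) = scan_round out (take l L) (scan out L v0 p)"
proof (induction l)
  case (Suc l)
  have "(p + l) mod length L = l"
    using Suc.prems by (auto simp: mod_add_eq mod_add_left_eq[symmetric, of p])
  then show ?case
    using Suc by (simp add: take_Suc_conv_app_nth)
qed simp

lemma scan_rounds: "scan out L v0 (length L * k) = (scan_round out L ^^ k) v0"
proof (induction k)
  case (Suc k)
  then show ?case
    using scan_add_take[of "length L * k" L "length L" out v0] by (simp add: add.commute)
qed simp

lemma scan_global_sink_mono:
  assumes "global_sink n out (scan out L v0 i)" "set L \<subseteq> directions n" "L \<noteq> []" "i \<le> j"
  shows "scan out L v0 j = scan out L v0 i"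
  using assms(4)
proof (induction j rule: dec_induct)
  case (step j)
  have "L ! (j mod length L) \<in> directions n"
    using assms(2,3) by (meson length_greater_0_conv mod_less_divisor nth_mem subsetD)
  then show ?case
    using step assms(1) by (simp add: scan_step_global_sink)
qed simp

section \<open>Cunningham's rule as a cyclic scan\<close>

lemma scan_order_eq:
  assumes "mu \<le> 2 * n"
  shows "scan_order n mu = map (\<lambda>r. (mu + r) mod (2 * n) + 1) [0..<2 * n]"
proof (rule nth_equalityI)
  show len: "length (scan_order n mu) = length (map (\<lambda>r. (mu + r) mod (2 * n) + 1) [0..<2 * n])"
    using assms by (auto simp: scan_order_def)
  fix i assume "i < length (scan_order n mu)"
  then have i: "i < 2 * n" using len by simp
  show "scan_order n mu ! i = map (\<lambda>r. (mu + r) mod (2 * n) + 1) [0..<2 * n] ! i"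
  proof (cases "mu + i < 2 * n")
    case True
    then show ?thesis using i by (auto simp: scan_order_def nth_append simp del: upt_Suc)
  next
    case False
    have "(mu + i) mod (2 * n) = mu + i - 2 * n"
      using False i assms by (simp add: mod_if)
    then show ?thesis
      using False i assms by (auto simp: scan_order_def nth_append simp del: upt_Suc)
  qed
qed

lemma scan_skip:
  assumes "\<And>r'. r' < r \<Longrightarrow> \<not> available out (scan out L v0 j) (L ! ((j + r') mod length L))"
  shows "scan out L v0 (j + r) = scan out L v0 j"
  using assms
  by (induction r) (simp_all add: scan_step_def)

text \<open>Cunningham's rule is the cyclic scan restricted to the times of its moves; a move happens
  at most one period after the previous one.\<close>

lemma cunningham_eq_scan:
  assumes "n > 0" "length L = 2 * n"
  shows "\<exists>j \<le> 2 * n * i. fst (cunningham n out L v0 i) = scan out L v0 j \<and>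
    snd (cunningham n out L v0 i) \<le> 2 * n \<and>
    snd (cunningham n out L v0 i) mod (2 * n) = j mod (2 * n)"
proof (induction i)
  case 0
  then show ?case by simp
next
  case (Suc i)
  obtain v mu where vmu: "cunningham n out L v0 i = (v, mu)" by fastforce
  obtain j where j: "j \<le> 2 * n * i" "v = scan out L v0 j" "mu \<le> 2 * n"
    "mu mod (2 * n) = j mod (2 * n)"
    using Suc.IH vmu by auto
  show ?case
  proof (cases "global_sink n out v \<or> next_index n out L v mu = None")
    case True
    then have "cunningham n out L v0 (Suc i) = (v, mu)"
      using vmu by auto
    then show ?thesis using j by (intro exI[of _ j]) auto
  next
    case False
    then obtain k where k: "next_index n out L v mu = Some k" by auto
    have cun: "cunningham n out L v0 (Suc i) = (flip v (nat \<bar>L ! (k - 1)\<bar>), k)"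
      using vmu k False by simp
    \<comment> \<open>Only the residue of the marker matters, so the initial marker
      \<open>2 * n\<close> agrees with time 0.\<close>
    have cong: "(mu + r) mod (2 * n) = (j + r) mod (2 * n)" for r
      using j(4) by (metis mod_add_left_eq)
    define g where "g = (\<lambda>r. (j + r) mod (2 * n) + 1)"
    have so: "scan_order n mu = map g [0..<2 * n]"
      using scan_order_eq[OF j(3)] cong by (simp add: g_def)
    obtain r where r: "r < 2 * n" "available out v (L ! (g r - 1))" "k = g r"
      "\<forall>r' < r. \<not> available out v (L ! (g r' - 1))"
    proof -
      obtain r where r: "r < length (map g [0..<2 * n])"
        "available out v (L ! (map g [0..<2 * n] ! r - 1))" "k = map g [0..<2 * n] ! r"
        "\<forall>r' < r. \<not> available out v (L ! (map g [0..<2 * n] ! r' - 1))"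
        using k unfolding next_index_def so find_Some_iff by blast
      have nth: "map g [0..<2 * n] ! r' = g r'" if "r' \<le> r" for r'
        using that r(1) by simp
      show ?thesis
      proof
        show "r < 2 * n" using r(1) by simp
        show "available out v (L ! (g r - 1))" using r(2) unfolding nth[OF order_refl] .
        show "k = g r" using r(3) unfolding nth[OF order_refl] .
        show "\<forall>r' < r. \<not> available out v (L ! (g r' - 1))" using r(4) nth less_imp_le by metis
      qed
    qed
    have skip: "scan out L v0 (j + r) = v"
      unfolding j(2) using r(4) by (intro scan_skip) (simp add: g_def assms(2) j(2))
    have "scan out L v0 (Suc (j + r)) = flip v (nat \<bar>L ! (k - 1)\<bar>)"
      using r(2,3) assms(2) by (simp add: skip scan_step_def g_def)
    moreover have "k \<le> 2 * n"
      using r(3) assms(1) mod_less_divisor[of "2 * n" "j + r"] by (simp add: g_def del: mod_less_divisor)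
    \<comment> \<open>The marker is 1-based and time is 0-based: the position of the move just made
      is, modulo \<open>2 * n\<close>, the index of the next inspection.\<close>
    moreover have "k mod (2 * n) = Suc (j + r) mod (2 * n)"
      using r(3) by (simp add: g_def mod_Suc_eq)
    moreover have "Suc (j + r) \<le> 2 * n * Suc i"
      using j(1) r(1) by simp
    ultimately show ?thesis
      using cun by (intro exI[of _ "Suc (j + r)"]) simp
  qed
qed

text \<open>Each step advances the scan by at most one period, so the vertex after \<open>i\<close>
  steps occurs in the scan within \<open>i\<close> rounds. The sink is absorbing: if
  \<open>i\<close> steps reached it, then so would \<open>i\<close> rounds.\<close>

lemma cunningham_not_global_sink:
  assumes "n > 0" "valid_list n L" "\<not> global_sink n out ((scan_round out L ^^ i) v0)"
  shows "\<not> global_sink n out (fst (cunningham n out L v0 i))"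
proof
  have L: "length L = 2 * n" "set L \<subseteq> directions n" "L \<noteq> []"
    using assms by (auto simp: valid_list_def)
  assume sink: "global_sink n out (fst (cunningham n out L v0 i))"
  obtain j where j: "j \<le> 2 * n * i" "fst (cunningham n out L v0 i) = scan out L v0 j"
    using cunningham_eq_scan[OF assms(1) L(1)] by blast
  then have "global_sink n out (scan out L v0 j)" using sink by simp
  then have "global_sink n out (scan out L v0 (2 * n * i))"
    using scan_global_sink_mono[OF _ L(2,3) j(1)] by metis
  moreover have "scan out L v0 (2 * n * i) = (scan_round out L ^^ i) v0"
    using scan_rounds[of out L v0 i] unfolding L(1) .
  ultimately show False using assms(3) by simp
qed

section \<open>Three-dimensional fibres\<close>

text \<open>The two nonuniform fibres (\<open>c\<close> and \<open>\<not> c\<close>) are exchanged by swapping the last two coordinates;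
  they were found by computer search. The flag \<open>e\<close> selects the uniform fibre over the old sink.\<close>

definition fib1 :: "bool \<Rightarrow> bool \<Rightarrow> bool \<Rightarrow> bool \<Rightarrow> bool \<Rightarrow> bool" where
  "fib1 e c p q r = (if e then \<not> p else if c then p \<noteq> r else p \<noteq> q)"

definition fib2 :: "bool \<Rightarrow> bool \<Rightarrow> bool \<Rightarrow> bool \<Rightarrow> bool \<Rightarrow> bool" where
  "fib2 e c p q r = (if e then \<not> q else if c then q \<noteq> (p \<and> r) else \<not> q)"

definition fib3 :: "bool \<Rightarrow> bool \<Rightarrow> bool \<Rightarrow> bool \<Rightarrow> bool \<Rightarrow> bool" where
  "fib3 e c p q r = (if e then \<not> r else if c then \<not> r else r \<noteq> (p \<and> q))"

text \<open>In a nonuniform fibre all edges on \<open>y\<close> point to \<open>y\<close> true. For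
  \<open>y\<close> false, \<open>p\<close> and \<open>x\<close> point to false; for \<open>y\<close>
  true, \<open>p\<close> points to true and \<open>x\<close> points to the value of
  \<open>p\<close>. The values follow this order. In the uniform fibre the rank is the Hamming
  distance to \<open>111\<close>.\<close>

definition fib_rank :: "bool \<Rightarrow> bool \<Rightarrow> bool \<Rightarrow> bool \<Rightarrow> bool \<Rightarrow> nat" where
  "fib_rank e c p q r =
    (if e then of_bool (\<not> p) + of_bool (\<not> q) + of_bool (\<not> r)
     else let x = if c then q else r; y = if c then r else q in
       if \<not> y then 4 + of_bool p + of_bool x
       else if p then of_bool (\<not> x) else 2 + of_bool x)"

lemmas fib_defs = fib1_def fib2_def fib3_def

definition fib_sink :: "bool \<Rightarrow> bool \<Rightarrow> bool \<Rightarrow> bool \<Rightarrow> bool \<Rightarrow> bool \<Rightarrow> bool \<Rightarrow> bool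
    \<Rightarrow> bool \<Rightarrow> bool \<Rightarrow> bool \<Rightarrow> bool" where
  "fib_sink e c C1 C2 C3 p0 q0 r0 p q r \<longleftrightarrow>
     (if C1 then \<not> fib1 e c p q r else p = p0) \<and>
     (if C2 then \<not> fib2 e c p q r else q = q0) \<and>
     (if C3 then \<not> fib3 e c p q r else r = r0)"

text \<open>The flags \<open>C1\<close>, \<open>C2\<close>, \<open>C3\<close> mark the free
  coordinates of a face of the 3-cube, so this says that each fibre is a USO. It is a finite
  check.\<close>

lemma fib_sink_unique:
  "\<exists>p q r. fib_sink e c C1 C2 C3 p0 q0 r0 p q r \<and>
     (\<forall>p' q' r'. fib_sink e c C1 C2 C3 p0 q0 r0 p' q' r' \<longrightarrow> p' = p \<and> q' = q \<and> r' = r)"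
  unfolding fib_sink_def fib_defs
  by (cases e; cases c; cases C1; cases C2; cases C3; cases p0; cases q0; cases r0;
      simp add: all_bool_eq ex_bool_eq)

lemma fib_rank_less_8: "fib_rank e c p q r < 8"
  by (simp add: fib_rank_def Let_def)

lemma fib_rank_decreasing:
  "fib1 e c p q r \<Longrightarrow> fib_rank e c (\<not> p) q r < fib_rank e c p q r"
  "fib2 e c p q r \<Longrightarrow> fib_rank e c p (\<not> q) r < fib_rank e c p q r"
  "fib3 e c p q r \<Longrightarrow> fib_rank e c p q (\<not> r) < fib_rank e c p q r"
  by (cases e; cases c; cases p; cases q; cases r; simp add: fib_defs fib_rank_def)+

lemma fib_flip:
  "fib1 e c p q r \<longleftrightarrow> \<not> fib1 e c (\<not> p) q r"
  "fib2 e c p q r \<longleftrightarrow> \<not> fib2 e c p (\<not> q) r"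
  "fib3 e c p q r \<longleftrightarrow> \<not> fib3 e c p q (\<not> r)"
  by (auto simp: fib_defs)

section \<open>The orientation on four more coordinates\<close>

definition emb :: "nat \<Rightarrow> nat set \<Rightarrow> bool \<Rightarrow> bool \<Rightarrow> bool \<Rightarrow> bool \<Rightarrow> nat set" where
  "emb n v p q r z = v \<union> {j. p \<and> j = n + 1 \<or> q \<and> j = n + 2 \<or> r \<and> j = n + 3 \<or> z \<and> j = n + 4}"

text \<open>Here \<open>t\<close> is meant to be the old sink, which gets the uniform fibre, and
  \<open>c\<close> chooses the fibre over the other vertices. The edge on \<open>n + 4\<close>
  points to the value of \<open>p \<and> q \<and> r\<close>, so \<open>z\<close> can rise only over
  \<open>111\<close>.\<close>

definition lift_out :: "nat \<Rightarrow> (nat set \<Rightarrow> nat \<Rightarrow> bool) \<Rightarrow> nat set \<Rightarrow> nat set \<Rightarrow> (nat set \<Rightarrow> bool)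
    \<Rightarrow> nat set \<Rightarrow> nat \<Rightarrow> bool" where
  "lift_out n out v0 t c u j =
    (let v = u \<inter> {1..n};
         p = n + 1 \<in> u; q = n + 2 \<in> u; r = n + 3 \<in> u; z = n + 4 \<in> u
     in if j \<le> n then (if p \<and> q \<and> r \<and> \<not> z then (j \<in> v) \<noteq> (j \<in> v0) else out v j)
        else if j = n + 1 then fib1 (v = t) (c v) p q r
        else if j = n + 2 then fib2 (v = t) (c v) p q r
        else if j = n + 3 then fib3 (v = t) (c v) p q r
        else (p \<and> q \<and> r) \<noteq> z)"

text \<open>The order matters. \<open>z\<close> comes first, so it is still 0 when, in the round
  that brings \<open>pqr\<close> to \<open>111\<close>, the part \<open>L\<close> resets the old
  coordinates. \<open>p\<close> comes before \<open>q\<close> and \<open>r\<close>, because in the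
  nonuniform fibres their change would make the edge on \<open>p\<close> outgoing.\<close>

definition lift_list :: "nat \<Rightarrow> int list \<Rightarrow> int list" where
  "lift_list n L = concat (map (\<lambda>j. [- int (n + j), int (n + j)]) [4, 1, 2, 3]) @ L"

lemma mem_emb:
  assumes "v \<in> vertices n"
  shows "j \<in> {1..n} \<Longrightarrow> j \<in> emb n v p q r z \<longleftrightarrow> j \<in> v"
    "n + 1 \<in> emb n v p q r z \<longleftrightarrow> p" "n + 2 \<in> emb n v p q r z \<longleftrightarrow> q"
    "n + 3 \<in> emb n v p q r z \<longleftrightarrow> r" "n + 4 \<in> emb n v p q r z \<longleftrightarrow> z"
  using assms by (auto simp: emb_def vertices_def)

lemma emb_inter: "v \<in> vertices n \<Longrightarrow> emb n v p q r z \<inter> {1..n} = v"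
  by (auto simp: emb_def vertices_def)

lemma emb_in_vertices: "v \<in> vertices n \<Longrightarrow> emb n v p q r z \<in> vertices (n + 4)"
  by (auto simp: emb_def vertices_def)

lemma atLeastAtMost_add4: "{1..n + 4} = {1..n} \<union> {n + 1, n + 2, n + 3, n + 4 :: nat}"
  by auto

lemma vertices_add4E:
  assumes "u \<in> vertices (n + 4)"
  obtains v p q r z where "v \<in> vertices n" "u = emb n v p q r z"
proof
  show "u \<inter> {1..n} \<in> vertices n" by (simp add: vertices_def)
  show "u = emb n (u \<inter> {1..n}) (n + 1 \<in> u) (n + 2 \<in> u) (n + 3 \<in> u) (n + 4 \<in> u)"
    using assms unfolding emb_def vertices_def atLeastAtMost_add4 by blast
qed

lemma flip_emb:
  assumes "v \<in> vertices n"
  shows "j \<in> {1..n} \<Longrightarrow> flip (emb n v p q r z) j = emb n (flip v j) p q r z"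
    "flip (emb n v p q r z) (n + 1) = emb n v (\<not> p) q r z"
    "flip (emb n v p q r z) (n + 2) = emb n v p (\<not> q) r z"
    "flip (emb n v p q r z) (n + 3) = emb n v p q (\<not> r) z"
    "flip (emb n v p q r z) (n + 4) = emb n v p q r (\<not> z)"
  using assms by (auto simp: emb_def vertices_def flip_def)

lemma lift_out_emb:
  assumes "v \<in> vertices n"
  shows "j \<in> {1..n} \<Longrightarrow> lift_out n out v0 t c (emb n v p q r z) j =
      (if p \<and> q \<and> r \<and> \<not> z then (j \<in> v) \<noteq> (j \<in> v0) else out v j)"
    "lift_out n out v0 t c (emb n v p q r z) (n + 1) = fib1 (v = t) (c v) p q r"
    "lift_out n out v0 t c (emb n v p q r z) (n + 2) = fib2 (v = t) (c v) p q r"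
    "lift_out n out v0 t c (emb n v p q r z) (n + 3) = fib3 (v = t) (c v) p q r"
    "lift_out n out v0 t c (emb n v p q r z) (n + 4) = ((p \<and> q \<and> r) \<noteq> z)"
  using assms
  by (simp_all only: lift_out_def Let_def emb_inter mem_emb) simp_all

lemma ball_atLeastAtMost_add4:
  "(\<forall>j \<in> {1..n + 4}. P j) \<longleftrightarrow>
    (\<forall>j \<in> {1..n}. P j) \<and> P (n + 1) \<and> P (n + 2) \<and> P (n + 3) \<and> P (n + 4)"
  for P :: "nat \<Rightarrow> bool"
  unfolding atLeastAtMost_add4 by auto

lemma lift_out_orientation:
  assumes "is_orientation n out"
  shows "is_orientation (n + 4) (lift_out n out v0 t c)"
  unfolding is_orientation_def
proof
  fix u assume "u \<in> vertices (n + 4)"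
  then obtain v p q r z where u: "v \<in> vertices n" "u = emb n v p q r z"
    by (rule vertices_add4E)
  have 1: "lift_out n out v0 t c u j \<longleftrightarrow> \<not> lift_out n out v0 t c (flip u j) j"
    if j: "j \<in> {1..n}" for j
  proof -
    have "out v j \<longleftrightarrow> \<not> out (flip v j) j"
      using assms u j by (simp add: is_orientation_def)
    moreover have "j \<in> flip v j \<longleftrightarrow> j \<notin> v" by (simp add: flip_def)
    ultimately show ?thesis
      using j by (simp add: u flip_emb lift_out_emb flip_in_vertices)
  qed
  show "\<forall>j \<in> {1..n + 4}. lift_out n out v0 t c u j \<longleftrightarrow> \<not> lift_out n out v0 t c (flip u j) j"
    unfolding ball_atLeastAtMost_add4
    unfolding u(2) flip_emb[OF u(1)] lift_out_emb[OF u(1)]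
    using 1[unfolded u(2)] fib_flip by blast
qed

text \<open>The only sink of every fibre is \<open>111\<close>. There \<open>z\<close> must be true,
  and then the old orientation governs the old coordinates.\<close>

lemma global_sink_lift_out:
  assumes v: "v \<in> vertices n"
  shows "global_sink (n + 4) (lift_out n out v0 t c) (emb n v p q r z) \<longleftrightarrow>
    p \<and> q \<and> r \<and> z \<and> global_sink n out v"
proof -
  have "global_sink (n + 4) (lift_out n out v0 t c) (emb n v p q r z) \<longleftrightarrow>
    (\<forall>j \<in> {1..n}. \<not> (if p \<and> q \<and> r \<and> \<not> z then (j \<in> v) \<noteq> (j \<in> v0) else out v j)) \<and>
    (\<not> fib1 (v = t) (c v) p q r \<and> \<not> fib2 (v = t) (c v) p q r \<and> \<not> fib3 (v = t) (c v) p q r) \<and>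
    (p \<and> q \<and> r) = z"
    unfolding global_sink_def ball_atLeastAtMost_add4 lift_out_emb(2-)[OF v]
    using lift_out_emb(1)[OF v] emb_in_vertices[OF v] by auto
  also have "\<not> fib1 (v = t) (c v) p q r \<and> \<not> fib2 (v = t) (c v) p q r \<and> \<not> fib3 (v = t) (c v) p q r
      \<longleftrightarrow> p \<and> q \<and> r"
    by (auto simp: fib_defs)
  finally show ?thesis
    using v by (auto simp: global_sink_def)
qed

section \<open>Faces of the lifted cube and their unique sinks\<close>

lemma face_emb:
  assumes "v \<in> vertices n" "w \<in> vertices n"
  shows "emb n v p q r z \<in> face C (emb n w p0 q0 r0 z0) \<longleftrightarrow>
    v \<in> face (C \<inter> {1..n}) w \<and> (n + 1 \<in> C \<or> p = p0) \<and> (n + 2 \<in> C \<or> q = q0) \<and>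
    (n + 3 \<in> C \<or> r = r0) \<and> (n + 4 \<in> C \<or> z = z0)"
proof -
  have vw: "v \<subseteq> {1..n}" "w \<subseteq> {1..n}" using assms by (auto simp: vertices_def)
  have "emb n v p q r z \<in> face C (emb n w p0 q0 r0 z0) \<longleftrightarrow>
    (\<forall>j. (j \<in> emb n v p q r z) \<noteq> (j \<in> emb n w p0 q0 r0 z0) \<longrightarrow> j \<in> C)"
    unfolding face_def by blast
  also have "\<dots> \<longleftrightarrow> (\<forall>j \<in> {1..n + 4}. (j \<in> emb n v p q r z) \<noteq> (j \<in> emb n w p0 q0 r0 z0) \<longrightarrow> j \<in> C)"
    using emb_in_vertices[OF assms(1)] emb_in_vertices[OF assms(2)] unfolding vertices_def by blast
  also have "\<dots> \<longleftrightarrow> (\<forall>j \<in> {1..n}. (j \<in> v) \<noteq> (j \<in> w) \<longrightarrow> j \<in> C) \<and>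
     (n + 1 \<in> C \<or> p = p0) \<and> (n + 2 \<in> C \<or> q = q0) \<and>
    (n + 3 \<in> C \<or> r = r0) \<and> (n + 4 \<in> C \<or> z = z0)"
    unfolding ball_atLeastAtMost_add4 mem_emb(2-)[OF assms(1)] mem_emb(2-)[OF assms(2)]
    using mem_emb(1)[OF assms(1)] mem_emb(1)[OF assms(2)] by auto
  also have "(\<forall>j \<in> {1..n}. (j \<in> v) \<noteq> (j \<in> w) \<longrightarrow> j \<in> C) \<longleftrightarrow> v \<in> face (C \<inter> {1..n}) w"
    using vw unfolding face_def by blast
  finally show ?thesis .
qed

lemma face_in_vertices: "w \<in> vertices n \<Longrightarrow> C \<subseteq> {1..n} \<Longrightarrow> v \<in> face C w \<Longrightarrow> v \<in> vertices n"
  by (auto simp: face_def vertices_def)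

lemma uniform_face_sink:
  "v \<in> face C w \<and> (\<forall>j \<in> C. \<not> (j \<in> v) \<noteq> (j \<in> v0)) \<longleftrightarrow> v = (v0 \<inter> C) \<union> (w - C)"
  by (auto simp: face_def)

text \<open>The sink of a face is found in stages: the old coordinates give \<open>v1\<close>, the
  fibre over \<open>v1\<close> gives \<open>pqr\<close>, and this determines \<open>z\<close>. If
  the outcome is \<open>pqr = 111\<close> with \<open>z = 0\<close>, the uniform orientation moves
  the sink from \<open>v1\<close> to \<open>v2\<close>.\<close>

lemma lift_out_uso:
  assumes "is_uso n out"
  shows "is_uso (n + 4) (lift_out n out v0 t c)"
  unfolding is_uso_def
proof (intro conjI allI impI ballI)
  show "is_orientation (n + 4) (lift_out n out v0 t c)"
    using assms lift_out_orientation by (simp add: is_uso_def)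
  fix C u0 assume C: "C \<subseteq> {1..n + 4}" and "u0 \<in> vertices (n + 4)"
  then obtain w p0 q0 r0 z0 where w: "w \<in> vertices n" and u0: "u0 = emb n w p0 q0 r0 z0"
    using vertices_add4E by metis
  define D where "D = C \<inter> {1..n}"
  have D: "D \<subseteq> {1..n}" by (simp add: D_def)
  obtain v1 where v1: "\<And>v. face_sink out D w v \<longleftrightarrow> v = v1"
    using assms w D unfolding is_uso_def by metis
  define v2 where "v2 = (v0 \<inter> D) \<union> (w - D)"
  have v12: "v1 \<in> vertices n" "v2 \<in> vertices n"
    using v1 face_in_vertices[OF w D] w D unfolding v2_def
    by (auto simp: face_sink_def) (auto simp: vertices_def)
  define F where "F = fib_sink (v1 = t) (c v1) (n + 1 \<in> C) (n + 2 \<in> C) (n + 3 \<in> C) p0 q0 r0"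
  have "\<exists>p q r. F p q r \<and> (\<forall>p' q' r'. F p' q' r' \<longrightarrow> p' = p \<and> q' = q \<and> r' = r)"
    unfolding F_def by (rule fib_sink_unique)
  then obtain p1 q1 r1 where F1: "F p1 q1 r1"
    "\<forall>p q r. F p q r \<longrightarrow> p = p1 \<and> q = q1 \<and> r = r1"
    by (elim exE conjE)
  have F: "F p q r \<longleftrightarrow> p = p1 \<and> q = q1 \<and> r = r1" for p q r
  proof
    assume "F p q r"
    then show "p = p1 \<and> q = q1 \<and> r = r1" using F1(2) by simp
  qed (use F1(1) in \<open>simp only:\<close>)
  have sink: "face_sink (lift_out n out v0 t c) C u0 (emb n v p q r z) \<longleftrightarrow>
      (if p \<and> q \<and> r \<and> \<not> z then v = v2 else v = v1) \<and> F p q r \<and>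
      (if n + 4 \<in> C then z = (p \<and> q \<and> r) else z = z0)"
    if v: "v \<in> vertices n" for v p q r z
  proof -
    have Csplit: "(\<forall>j \<in> C. P j) \<longleftrightarrow> (\<forall>j \<in> D. P j) \<and> (n + 1 \<in> C \<longrightarrow> P (n + 1)) \<and>
        (n + 2 \<in> C \<longrightarrow> P (n + 2)) \<and> (n + 3 \<in> C \<longrightarrow> P (n + 3)) \<and> (n + 4 \<in> C \<longrightarrow> P (n + 4))" for P
      using C unfolding D_def atLeastAtMost_add4 by blast
    have base: "v \<in> face D w \<and> (\<forall>j \<in> D. \<not> lift_out n out v0 t c (emb n v p q r z) j) \<longleftrightarrow>
       (if p \<and> q \<and> r \<and> \<not> z then v = v2 else v = v1)"
    proof -
      have "(\<forall>j \<in> D. \<not> lift_out n out v0 t c (emb n v p q r z) j) \<longleftrightarrow>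
        (\<forall>j \<in> D. \<not> (if p \<and> q \<and> r \<and> \<not> z then (j \<in> v) \<noteq> (j \<in> v0) else out v j))"
        by (intro ball_cong refl arg_cong[where f = Not] lift_out_emb(1)[OF v]) (use D in blast)
      then show ?thesis
        using uniform_face_sink[of v D w v0] v1[of v] unfolding v2_def face_sink_def
        by (cases "p \<and> q \<and> r \<and> \<not> z") (simp_all only: if_True if_False simp_thms)
    qed
    have "face_sink (lift_out n out v0 t c) C u0 (emb n v p q r z) \<longleftrightarrow>
      (v \<in> face D w \<and> (\<forall>j \<in> D. \<not> lift_out n out v0 t c (emb n v p q r z) j)) \<and>
      fib_sink (v = t) (c v) (n + 1 \<in> C) (n + 2 \<in> C) (n + 3 \<in> C) p0 q0 r0 p q r \<and>
      (if n + 4 \<in> C then z = (p \<and> q \<and> r) else z = z0)"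
      unfolding face_sink_def Csplit u0 face_emb[OF v w] D_def[symmetric]
        lift_out_emb(2-)[OF v] fib_sink_def by auto
    also have "\<dots> \<longleftrightarrow> (if p \<and> q \<and> r \<and> \<not> z then v = v2 else v = v1) \<and>
        fib_sink (v = t) (c v) (n + 1 \<in> C) (n + 2 \<in> C) (n + 3 \<in> C) p0 q0 r0 p q r \<and>
      (if n + 4 \<in> C then z = (p \<and> q \<and> r) else z = z0)"
      unfolding base ..
    also have "\<dots> \<longleftrightarrow> (if p \<and> q \<and> r \<and> \<not> z then v = v2 else v = v1) \<and> F p q r \<and>
      (if n + 4 \<in> C then z = (p \<and> q \<and> r) else z = z0)"
    \<comment> \<open>All fibres have their sink at \<open>111\<close>, so the condition there does
      not depend on \<open>v\<close>. Hence \<open>F\<close>, which is set up over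
      \<open>v1\<close>, also serves for \<open>v = v2\<close>.\<close>
    proof (cases "p \<and> q \<and> r")
      case True
      then have "p = True" "q = True" "r = True" by simp_all
      moreover have "fib_sink (v = t) (c v) (n + 1 \<in> C) (n + 2 \<in> C) (n + 3 \<in> C) p0 q0 r0 True True True
          = F True True True"
        by (simp add: F_def fib_sink_def fib_defs)
      ultimately show ?thesis by (simp only:)
    next
      case False
      then show ?thesis unfolding F_def by auto
    qed
    finally show ?thesis .
  qed
  define z1 where "z1 = (if n + 4 \<in> C then p1 \<and> q1 \<and> r1 else z0)"
  define v3 where "v3 = (if p1 \<and> q1 \<and> r1 \<and> \<not> z1 then v2 else v1)"
  have v3: "v3 \<in> vertices n" using v12 by (simp add: v3_def)
  show "\<exists>!u. face_sink (lift_out n out v0 t c) C u0 u"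
  proof
    show "face_sink (lift_out n out v0 t c) C u0 (emb n v3 p1 q1 r1 z1)"
      unfolding sink[OF v3] F by (cases p1; cases q1; cases r1) (simp_all add: v3_def z1_def)
    fix u assume u: "face_sink (lift_out n out v0 t c) C u0 u"
    have "u \<in> vertices (n + 4)"
      using u face_in_vertices[OF \<open>u0 \<in> vertices (n + 4)\<close> C] by (simp add: face_sink_def)
    then obtain v p q r z where uv: "v \<in> vertices n" "u = emb n v p q r z"
      by (rule vertices_add4E)
    have "(if p \<and> q \<and> r \<and> \<not> z then v = v2 else v = v1) \<and> (p = p1 \<and> q = q1 \<and> r = r1) \<and>
      (if n + 4 \<in> C then z = (p \<and> q \<and> r) else z = z0)"
      using u sink[OF uv(1)] unfolding uv(2) F by blast
    then show "u = emb n v3 p1 q1 r1 z1"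
      unfolding uv(2) by (auto simp: v3_def z1_def split: if_splits)
  qed
qed

section \<open>A rank function for the lifted orientation\<close>

lemma lift_out_rank:
  fixes h :: "nat set \<Rightarrow> nat"
  assumes h: "\<And>v j. v \<in> vertices n \<Longrightarrow> j \<in> {1..n} \<Longrightarrow> out v j \<Longrightarrow> h (flip v j) < h v"
    and v0: "v0 \<in> vertices n"
  shows "\<exists>h' :: nat set \<Rightarrow> nat. \<forall>u \<in> vertices (n + 4). \<forall>j \<in> {1..n + 4}.
    lift_out n out v0 t c u j \<longrightarrow> h' (flip u j) < h' u"
proof -
  have "finite (h ` vertices n)" by (simp add: vertices_def)
  then obtain B where B: "\<And>v. v \<in> vertices n \<Longrightarrow> h v < B"
    by (meson finite_nat_set_iff_bounded imageI)
  define dist where "dist v = card ((v - v0) \<union> (v0 - v))" for v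
  have dist_le: "dist v \<le> n" if "v \<in> vertices n" for v
  proof -
    have "dist v \<le> card {1..n}"
      unfolding dist_def using that v0 by (intro card_mono) (auto simp: vertices_def)
    then show ?thesis by simp
  qed
  have dist_flip: "dist (flip v j) < dist v"
    if "v \<in> vertices n" "(j \<in> v) \<noteq> (j \<in> v0)" for v j
  proof -
    have "finite ((v - v0) \<union> (v0 - v))"
      using that(1) v0 finite_subset[of _ "{1..n}"] unfolding vertices_def by blast
    moreover have "(flip v j - v0) \<union> (v0 - flip v j) = ((v - v0) \<union> (v0 - v)) - {j}"
      using that(2) by (auto simp: flip_def)
    moreover have "j \<in> (v - v0) \<union> (v0 - v)" using that(2) by blast
    ultimately show ?thesis unfolding dist_def by (simp only: card_Diff1_less)
  qed
  \<comment> \<open>Three zones: \<open>111\<close> with \<open>z\<close> true lies below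
    \<open>B\<close>, \<open>111\<close> with \<open>z\<close> false lies between \<open>B\<close>
    and \<open>B + n\<close>, everything else lies above. In the last zone the fibre rank and
    \<open>z\<close> contribute at most 15, so the factor 16 lets an old move outweigh the change of
    fibre it may cause.\<close>
  define g where "g v p q r z =
     (if p \<and> q \<and> r then (if z then h v else B + dist v)
      else B + n + 1 + 16 * h v + 2 * fib_rank (v = t) (c v) p q r + of_bool z)" for v p q r z
  define h' where "h' u = g (u \<inter> {1..n}) (n + 1 \<in> u) (n + 2 \<in> u) (n + 3 \<in> u) (n + 4 \<in> u)" for u
  have h'_emb: "h' (emb n v p q r z) = g v p q r z" if "v \<in> vertices n" for v p q r z
    unfolding h'_def mem_emb[OF that] emb_inter[OF that] ..
  have top: "g v True True True z < g v p q r z'" if "v \<in> vertices n" "\<not> (p \<and> q \<and> r)" for v p q r z z'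
    using that B[OF that(1)] dist_le[OF that(1)] by (auto simp: g_def)
  have fib_step: "g v p' q' r' z < g v p q r z"
    if "v \<in> vertices n" "\<not> (p \<and> q \<and> r)"
      "fib_rank (v = t) (c v) p' q' r' < fib_rank (v = t) (c v) p q r" for v p q r p' q' r' z
  proof (cases "p' \<and> q' \<and> r'")
    case True
    then show ?thesis using top[OF that(1,2)] by simp
  next
    case False
    then show ?thesis using that(2,3) by (auto simp: g_def)
  qed
  have "h' (flip u j) < h' u"
    if u: "u \<in> vertices (n + 4)" and j: "j \<in> {1..n + 4}" and o: "lift_out n out v0 t c u j" for u j
  proof -
    obtain v p q r z where uv: "v \<in> vertices n" "u = emb n v p q r z"
      using u by (rule vertices_add4E)
    consider "j \<in> {1..n}" | "j = n + 1" | "j = n + 2" | "j = n + 3" | "j = n + 4"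
      using j unfolding atLeastAtMost_add4 by blast
    then show ?thesis
    proof cases
      case 1
      note fv = flip_in_vertices[OF uv(1) 1]
      have o': "if p \<and> q \<and> r \<and> \<not> z then (j \<in> v) \<noteq> (j \<in> v0) else out v j"
        using o lift_out_emb(1)[OF uv(1) 1] unfolding uv(2) by simp
      have "g (flip v j) p q r z < g v p q r z"
      proof (cases "p \<and> q \<and> r \<and> \<not> z")
        case True
        then show ?thesis using o' dist_flip[OF uv(1)] by (simp add: g_def)
      next
        case False
        then have lt: "h (flip v j) < h v" using h[OF uv(1) 1] o' by auto
        then show ?thesis
          using False fib_rank_less_8[of "flip v j = t" "c (flip v j)" p q r] by (auto simp: g_def)
      qed
      then show ?thesis
        using flip_emb(1)[OF uv(1) 1] h'_emb[OF uv(1)] h'_emb[OF fv] uv(2) by simp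
    next
      case 2
      have f: "fib1 (v = t) (c v) p q r"
        using o unfolding uv(2) 2 lift_out_emb[OF uv(1)] .
      then have "\<not> (p \<and> q \<and> r)" by (auto simp: fib_defs split: if_splits)
      then show ?thesis
        unfolding uv(2) 2 flip_emb[OF uv(1)] h'_emb[OF uv(1)]
        using f by (intro fib_step[OF uv(1)] fib_rank_decreasing)
    next
      case 3
      have f: "fib2 (v = t) (c v) p q r"
        using o unfolding uv(2) 3 lift_out_emb[OF uv(1)] .
      then have "\<not> (p \<and> q \<and> r)" by (auto simp: fib_defs split: if_splits)
      then show ?thesis
        unfolding uv(2) 3 flip_emb[OF uv(1)] h'_emb[OF uv(1)]
        using f by (intro fib_step[OF uv(1)] fib_rank_decreasing)
    next
      case 4
      have f: "fib3 (v = t) (c v) p q r"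
        using o unfolding uv(2) 4 lift_out_emb[OF uv(1)] .
      then have "\<not> (p \<and> q \<and> r)" by (auto simp: fib_defs split: if_splits)
      then show ?thesis
        unfolding uv(2) 4 flip_emb[OF uv(1)] h'_emb[OF uv(1)]
        using f by (intro fib_step[OF uv(1)] fib_rank_decreasing)
    next
      case 5
      then show ?thesis
        using o B[OF uv(1)] unfolding uv(2) 5 flip_emb[OF uv(1)] h'_emb[OF uv(1)] lift_out_emb[OF uv(1)]
        by (auto simp: g_def)
    qed
  qed
  then show ?thesis by blast
qed

section \<open>Rounds of the lifted list\<close>

lemma valid_list_lift_list:
  assumes "valid_list n L"
  shows "valid_list (n + 4) (lift_list n L)"
proof -
  have L: "distinct L" "set L = directions n" "length L = 2 * n"
    using assms by (auto simp: valid_list_def)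
  have "set (lift_list n L) = directions (n + 4)"
    unfolding lift_list_def by (auto simp: L directions_iff)
  moreover have "distinct (lift_list n L)"
    unfolding lift_list_def by (auto simp: L directions_iff)
  ultimately show ?thesis
    by (simp add: valid_list_def lift_list_def L)
qed

lemma scan_step_emb:
  assumes v: "v \<in> vertices n" and d: "d \<in> directions n"
  shows "scan_step (lift_out n out v0 t c) (emb n v p q r z) d =
    emb n (scan_step (if p \<and> q \<and> r \<and> \<not> z then \<lambda>v j. (j \<in> v) \<noteq> (j \<in> v0) else out) v d) p q r z"
proof -
  have j: "nat \<bar>d\<bar> \<in> {1..n}" using d by (simp add: directions_iff)
  have "available (lift_out n out v0 t c) (emb n v p q r z) d \<longleftrightarrow>
    available (if p \<and> q \<and> r \<and> \<not> z then \<lambda>v j. (j \<in> v) \<noteq> (j \<in> v0) else out) v d"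
    using j lift_out_emb(1)[OF v j] mem_emb(1)[OF v j]
    by (auto simp: available_def)
  then show ?thesis
    using flip_emb(1)[OF v j] by (simp add: scan_step_def)
qed

lemma scan_round_emb:
  assumes "set L \<subseteq> directions n" "v \<in> vertices n"
  shows "scan_round (lift_out n out v0 t c) L (emb n v p q r z) =
    emb n (scan_round (if p \<and> q \<and> r \<and> \<not> z then \<lambda>v j. (j \<in> v) \<noteq> (j \<in> v0) else out) L v) p q r z"
  using assms
  by (induction L arbitrary: v) (simp_all only: foldl.simps scan_step_emb scan_step_in_vertices
      list.set insert_subset)

text \<open>A disagreement with \<open>v0\<close> is never created, and one at \<open>j\<close> is
  repaired as soon as the direction leaving \<open>v\<close> along \<open>j\<close> is
  inspected.\<close>

lemma scan_round_uniform_disagree: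
  assumes "(j \<in> scan_round (\<lambda>v j. (j \<in> v) \<noteq> (j \<in> v0)) L v) \<noteq> (j \<in> v0)" "j > 0"
  shows "(j \<in> v) \<noteq> (j \<in> v0) \<and> (if j \<in> v then - int j else int j) \<notin> set L"
  using assms
proof (induction L arbitrary: v)
  case (Cons d L)
  let ?w = "scan_step (\<lambda>v j. (j \<in> v) \<noteq> (j \<in> v0)) v d"
  have IH: "(j \<in> ?w) \<noteq> (j \<in> v0)" "(if j \<in> ?w then - int j else int j) \<notin> set L"
    using Cons.IH[of ?w] Cons.prems by auto
  have "(j \<in> ?w) = (j \<in> v) \<and> (if j \<in> v then - int j else int j) \<noteq> d"
    using IH(1) Cons.prems(2)
    by (auto simp: scan_step_def available_def flip_def split: if_splits)
  then show ?case using IH by auto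
qed auto

text \<open>A list of all directions meets every initial disagreement within one round. This is the
  reset between the two runs of the old walk.\<close>

lemma scan_round_uniform:
  assumes "set L = directions n" "v \<in> vertices n" "v0 \<in> vertices n"
  shows "scan_round (\<lambda>v j. (j \<in> v) \<noteq> (j \<in> v0)) L v = v0"
proof -
  let ?u = "\<lambda>v j. (j \<in> v) \<noteq> (j \<in> v0)"
  have w: "scan_round ?u L v \<in> vertices n"
    using scan_round_in_vertices assms(1,2) by blast
  have "(j \<in> scan_round ?u L v) = (j \<in> v0)" for j
  proof (cases "j \<in> {1..n}")
    case True
    then have "(if j \<in> v then - int j else int j) \<in> set L"
      by (simp add: assms(1) directions_iff)
    then show ?thesis
      using scan_round_uniform_disagree[where j = j and v = v and L = L and ?v0.0 = v0] True by auto
  next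
    case False
    then show ?thesis using w assms(3) by (auto simp: vertices_def)
  qed
  then show ?thesis by blast
qed

text \<open>The results are Boolean expressions instead of case distinctions, so that the eight
  steps of the new prefix compose by rewriting.\<close>

lemma scan_step_emb_add:
  fixes n :: nat and out :: "nat set \<Rightarrow> nat \<Rightarrow> bool" and v0 t :: "nat set" and c :: "nat set \<Rightarrow> bool"
  assumes v: "v \<in> vertices n"
  defines "lo \<equiv> lift_out n out v0 t c"
  shows
    "scan_step lo (emb n v p q r z) (- int (n + 1)) = emb n v (p \<and> \<not> fib1 (v = t) (c v) p q r) q r z"
    "scan_step lo (emb n v p q r z) (int (n + 1)) = emb n v (p \<or> fib1 (v = t) (c v) p q r) q r z"
    "scan_step lo (emb n v p q r z) (- int (n + 2)) = emb n v p (q \<and> \<not> fib2 (v = t) (c v) p q r) r z"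
    "scan_step lo (emb n v p q r z) (int (n + 2)) = emb n v p (q \<or> fib2 (v = t) (c v) p q r) r z"
    "scan_step lo (emb n v p q r z) (- int (n + 3)) = emb n v p q (r \<and> \<not> fib3 (v = t) (c v) p q r) z"
    "scan_step lo (emb n v p q r z) (int (n + 3)) = emb n v p q (r \<or> fib3 (v = t) (c v) p q r) z"
    "scan_step lo (emb n v p q r z) (- int (n + 4)) = emb n v p q r (z \<and> p \<and> q \<and> r)"
    "scan_step lo (emb n v p q r z) (int (n + 4)) = emb n v p q r (z \<or> p \<and> q \<and> r)"
proof -
  have step: "scan_step lo u (- int m) = (if m \<in> u \<and> lo u m then flip u m else u)"
    "scan_step lo u (int m) = (if m \<notin> u \<and> lo u m then flip u m else u)"
    if "m > 0" for u m
    using that by (auto simp: scan_step_def available_def)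
  have pos: "0 < n + 1" "0 < n + 2" "0 < n + 3" "0 < n + 4" by simp_all
  show
    "scan_step lo (emb n v p q r z) (- int (n + 1)) = emb n v (p \<and> \<not> fib1 (v = t) (c v) p q r) q r z"
    "scan_step lo (emb n v p q r z) (int (n + 1)) = emb n v (p \<or> fib1 (v = t) (c v) p q r) q r z"
    "scan_step lo (emb n v p q r z) (- int (n + 2)) = emb n v p (q \<and> \<not> fib2 (v = t) (c v) p q r) r z"
    "scan_step lo (emb n v p q r z) (int (n + 2)) = emb n v p (q \<or> fib2 (v = t) (c v) p q r) r z"
    "scan_step lo (emb n v p q r z) (- int (n + 3)) = emb n v p q (r \<and> \<not> fib3 (v = t) (c v) p q r) z"
    "scan_step lo (emb n v p q r z) (int (n + 3)) = emb n v p q (r \<or> fib3 (v = t) (c v) p q r) z"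
    "scan_step lo (emb n v p q r z) (- int (n + 4)) = emb n v p q r (z \<and> p \<and> q \<and> r)"
    "scan_step lo (emb n v p q r z) (int (n + 4)) = emb n v p q r (z \<or> p \<and> q \<and> r)"
    by (simp_all only: step pos, simp_all only: lo_def mem_emb(2-)[OF v] lift_out_emb(2-)[OF v] flip_emb(2-)[OF v],
      (cases p; cases q; cases r; simp)+)
qed

text \<open>The prefix acts on \<open>zpqr\<close> over a fixed \<open>v\<close>; then
  \<open>L\<close> runs under the orientation that the outcome selects. The first two cases advance
  the old walk while \<open>pqr\<close> alternates, the third is the reset, the fourth sets
  \<open>z\<close> if necessary and advances the second run.\<close>

lemma scan_round_lift_list:
  fixes n :: nat and out :: "nat set \<Rightarrow> nat \<Rightarrow> bool" and v0 t :: "nat set" and c :: "nat set \<Rightarrow> bool"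
  assumes v: "v \<in> vertices n" and L: "set L \<subseteq> directions n"
  defines "R \<equiv> scan_round (lift_out n out v0 t c) (lift_list n L)"
  shows
    "v \<noteq> t \<Longrightarrow> c v \<Longrightarrow>
      R (emb n v False True False False) = emb n (scan_round out L v) False False True False"
    "v \<noteq> t \<Longrightarrow> \<not> c v \<Longrightarrow>
      R (emb n v False False True False) = emb n (scan_round out L v) False True False False"
    "t = v \<Longrightarrow> q \<noteq> r \<Longrightarrow> R (emb n v False q r False) =
      emb n (scan_round (\<lambda>v j. (j \<in> v) \<noteq> (j \<in> v0)) L v) True True True False"
    "R (emb n v True True True z) = emb n (scan_round out L v) True True True True"
  unfolding R_def lift_list_def
  by (simp_all only: list.map concat.simps append.simps foldl.simps foldl_append
      scan_step_emb_add[OF v])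
    (auto simp: fib_defs scan_round_emb[OF L v])

section \<open>Doubling the number of rounds\<close>

text \<open>Length is counted in complete rounds. The equivalence makes \<rho> exact, so the round
  that reaches the sink is known. The rank \<open>h\<close> gives acyclicity and separates the ends
  of rounds.\<close>

definition slow :: "nat \<Rightarrow> nat \<Rightarrow> bool" where
  "slow n \<rho> \<longleftrightarrow> (\<exists>out (h :: nat set \<Rightarrow> nat) v0 L. is_uso n out \<and>
     (\<forall>v \<in> vertices n. \<forall>j \<in> {1..n}. out v j \<longrightarrow> h (flip v j) < h v) \<and>
     v0 \<in> vertices n \<and> valid_list n L \<and>
     (\<forall>k. global_sink n out ((scan_round out L ^^ k) v0) \<longleftrightarrow> \<rho> \<le> k))"

lemma slow_0: "slow 0 0"
proof -
  have "is_uso 0 (\<lambda>_ _. False)"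
    by (auto simp: is_uso_def is_orientation_def face_sink_def face_def)
  moreover have "((\<lambda>v. v) ^^ k) {} = ({} :: nat set)" for k
    by (induction k) simp_all
  ultimately show ?thesis
    unfolding slow_def
    by (intro exI[of _ "\<lambda>_ _. False"] exI[of _ "\<lambda>_. 0"] exI[of _ "{}"] exI[of _ "[]"])
      (simp add: vertices_def valid_list_def directions_def global_sink_def)
qed

text \<open>The first run takes \<rho> rounds, the reset one, the second run
  \<open>max 1 \<rho>\<close>. The maximum accounts for \<rho> = 0, where a round is still spent on
  setting \<open>z\<close>.\<close>

lemma slow_add4:
  assumes "slow n \<rho>"
  shows "slow (n + 4) (\<rho> + 1 + max 1 \<rho>)"
proof -
  obtain out v0 L and h :: "nat set \<Rightarrow> nat" where uso: "is_uso n out"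
    and h: "\<And>v j. v \<in> vertices n \<Longrightarrow> j \<in> {1..n} \<Longrightarrow> out v j \<Longrightarrow> h (flip v j) < h v"
    and v0: "v0 \<in> vertices n" and L: "valid_list n L"
    and sink: "\<And>k. global_sink n out ((scan_round out L ^^ k) v0) \<longleftrightarrow> \<rho> \<le> k"
    using assms unfolding slow_def by metis
  define V where "V k = (scan_round out L ^^ k) v0" for k
  have sink: "global_sink n out (V k) \<longleftrightarrow> \<rho> \<le> k" for k
    using sink by (simp add: V_def)
  have V0: "V 0 = v0" and VSuc: "scan_round out L (V k) = V (Suc k)" for k
    by (simp_all add: V_def)
  have L': "set L = directions n" using L by (simp add: valid_list_def)
  have V: "V k \<in> vertices n" for k
  proof (induction k)
    case (Suc k)
    then show ?case using scan_round_in_vertices[of L n "V k" out] L' VSuc by simp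
  qed (simp add: V0 v0)
  have dec: "h (V (Suc k)) < h (V k)" if "k < \<rho>" for k
  proof -
    have "\<not> global_sink n out (V k)" using sink that by simp
    then have "\<exists>d \<in> set L. available out (V k) d"
      using exists_available V L' by metis
    then show ?thesis
      using scan_round_decreasing[of n out h L "V k"] h V L' VSuc by auto
  qed
  have lt: "h (V l) < h (V k)" if "k < l" "l \<le> \<rho>" for k l
    using that
  proof (induction l)
    case (Suc l)
    then show ?case using dec[of l] by (cases "k = l") force+
  qed simp
  \<comment> \<open>Distinctness of \<open>V 0\<close>, ..., \<open>V \<rho>\<close> makes the
    parity of the round index a function of the vertex, which is what \<open>c\<close>
    encodes.\<close>
  have inj: "V k = V l \<longleftrightarrow> k = l" if "k \<le> \<rho>" "l \<le> \<rho>" for k l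
    using lt[of k l] lt[of l k] that by (cases k l rule: linorder_cases) auto
  define c where "c v = (\<exists>k < \<rho>. even k \<and> V k = v)" for v
  have c: "c (V k) \<longleftrightarrow> even k" if "k < \<rho>" for k
    using that inj by (force simp: c_def)
  define lo where "lo = lift_out n out v0 (V \<rho>) c"
  define L4 where "L4 = lift_list n L"
  \<comment> \<open>The start \<open>010\<close> is the state that the fibre with \<open>c\<close>
    true turns into \<open>001\<close>; \<open>c\<close> assigns this fibre to even rounds.\<close>
  define U where "U k = (scan_round lo L4 ^^ k) (emb n v0 False True False False)" for k
  have USuc: "U (Suc k) = scan_round lo L4 (U k)" for k by (simp add: U_def)
  note round = scan_round_lift_list[where L = L and out = out and ?v0.0 = v0 and t = "V \<rho>" and c = c,
      OF V, folded lo_def L4_def]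
  have U1: "U k = emb n (V k) False (even k) (odd k) False" if "k \<le> \<rho>" for k
    using that
  proof (induction k)
    case 0
    then show ?case by (simp add: U_def V0)
  next
    case (Suc k)
    then have "V k \<noteq> V \<rho>" using inj by simp
    then show ?case
      using Suc round(1,2)[of k] L' c[of k] VSuc by (cases "even k") (simp_all add: USuc)
  qed
  \<comment> \<open>Whichever of \<open>010\<close> and \<open>001\<close> the parity of \<rho>
    produces, the uniform fibre over \<open>V \<rho>\<close> raises it to
    \<open>111\<close>.\<close>
  have U2: "U (\<rho> + 1) = emb n v0 True True True False"
    using round(3)[of \<rho> "even \<rho>" "odd \<rho>"] U1[of \<rho>] L' scan_round_uniform[OF L' V v0]
    by (simp add: USuc)
  \<comment> \<open>The round that sets \<open>z\<close> is already the first round of the second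
    run, hence \<open>V (Suc k)\<close>.\<close>
  have U3: "U (\<rho> + 1 + Suc k) = emb n (V (Suc k)) True True True True" for k
  proof (induction k)
    case 0
    then show ?case using U2 round(4)[of 0 False] L' VSuc[of 0] by (simp add: USuc V0)
  next
    case (Suc k)
    then show ?case using round(4)[of "Suc k" True] L' by (simp add: USuc VSuc)
  qed
  have sinkU: "global_sink (n + 4) lo (U k) \<longleftrightarrow> \<rho> + 1 + max 1 \<rho> \<le> k" for k
  proof -
    have "k \<le> \<rho> \<or> k = \<rho> + 1 \<or> k = \<rho> + 1 + Suc (k - \<rho> - 2)"
      by arith
    then consider "k \<le> \<rho>" | "k = \<rho> + 1" | i where "k = \<rho> + 1 + Suc i"
      by blast
    then show ?thesis
    proof cases
      case 1
      then show ?thesis unfolding U1[OF 1] lo_def global_sink_lift_out[OF V] by simp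
    next
      case 2
      then show ?thesis unfolding 2 U2 lo_def global_sink_lift_out[OF v0] by simp
    next
      case 3
      then show ?thesis unfolding 3 U3 lo_def global_sink_lift_out[OF V] sink by auto
    qed
  qed
  obtain h' :: "nat set \<Rightarrow> nat" where
    "\<forall>u \<in> vertices (n + 4). \<forall>j \<in> {1..n + 4}. lo u j \<longrightarrow> h' (flip u j) < h' u"
    using lift_out_rank[OF h v0] unfolding lo_def by blast
  then show ?thesis
    unfolding slow_def
    using lift_out_uso[OF uso] emb_in_vertices[OF v0] valid_list_lift_list[OF L] sinkU
    unfolding U_def lo_def L4_def by blast
qed

section \<open>The exponential lower bound\<close>

text \<open>Four new coordinates at least double \<rho>. The doubling starts from
  \<open>m = 1\<close>, where \<open>slow_0\<close> leads to 0 + 1 + 1 = 2; at \<open>m = 0\<close>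
  the count 0 is below \<open>2 ^ 0\<close>.\<close>

lemma slow_exponential: "m > 0 \<Longrightarrow> \<exists>\<rho> \<ge> 2 ^ m. slow (4 * m) \<rho>"
proof (induction m)
  case (Suc m)
  show ?case
  proof (cases "m = 0")
    case True
    have "slow 4 2" using slow_add4[OF slow_0] by (simp add: numeral_2_eq_2)
    then show ?thesis using True by auto
  next
    case False
    then obtain \<rho> where \<rho>: "2 ^ m \<le> \<rho>" "slow (4 * m) \<rho>"
      using Suc.IH by blast
    then show ?thesis
      using slow_add4[OF \<rho>(2)] by (intro exI[of _ "\<rho> + 1 + max 1 \<rho>"]) (simp add: add.commute)
  qed
qed simp

lemma acyclic_if_rank:
  fixes h :: "nat set \<Rightarrow> nat"
  assumes "\<forall>v \<in> vertices n. \<forall>j \<in> {1..n}. out v j \<longrightarrow> h (flip v j) < h v"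
  shows "acyclic (orient_edges n out)"
proof -
  have "(orient_edges n out)\<inverse> \<subseteq> measure h"
    using assms by (auto simp: orient_edges_def)
  then have "wf ((orient_edges n out)\<inverse>)"
    using wf_subset by blast
  then show ?thesis
    using wf_acyclic acyclic_converse by blast
qed

theorem theorem3:
  fixes n :: nat
  assumes "n > 0" and "4 dvd n"
  shows "\<exists>out v0 L. is_auso n out \<and> v0 \<in> vertices n \<and> valid_list n L \<and>
           (\<forall>i < 2 ^ (n div 4). \<not> global_sink n out (fst (cunningham n out L v0 i)))"
proof -
  obtain m where m: "n = 4 * m" using assms(2) by blast
  then obtain \<rho> where \<rho>: "2 ^ (n div 4) \<le> \<rho>" "slow n \<rho>"
    using slow_exponential[of m] assms(1) by auto
  then obtain out v0 L and h :: "nat set \<Rightarrow> nat" where uso: "is_uso n out"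
    and h: "\<forall>v \<in> vertices n. \<forall>j \<in> {1..n}. out v j \<longrightarrow> h (flip v j) < h v"
    and v0: "v0 \<in> vertices n" and L: "valid_list n L"
    and sink: "\<And>k. global_sink n out ((scan_round out L ^^ k) v0) \<longleftrightarrow> \<rho> \<le> k"
    unfolding slow_def by metis
  have "is_auso n out"
    using uso acyclic_if_rank[OF h] by (simp add: is_auso_def)
  \<comment> \<open>Reaching the sink in \<open>i\<close> steps would force it within
    \<open>i\<close> rounds, but \<open>i < \<rho>\<close>.\<close>
  moreover have "\<not> global_sink n out (fst (cunningham n out L v0 i))" if "i < 2 ^ (n div 4)" for i
    using cunningham_not_global_sink[OF assms(1) L] sink[of i] that \<rho>(1) by simp
  ultimately show ?thesis using v0 L by blast
qed

end
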